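(* Let $N(m,n)$ be the number of all threshold functions on $\{0,1,\dots,m\}\times\{0,1,\dots,n\}$, where $m,n$ are positive integers. For $m\ge n$, the following asymptotics hold: $$N(m,n) = \frac{6}{\pi^2}\, m^2n^2 + O(m^2 n\ln n),$$ $$N(m,n) = 2\bigl((n+1)\Psi(n)-\Phi(n)\bigr)m^2 + O(mn^3),$$ where $\varphi$ is Euler's totient function and $$\Phi(k)=\sum_{i=1}^k\varphi(i)=\frac{3}{\pi^2}k^2+O(k\ln k)\quad\text{(Dirichlet's Theorem)},$$ $$\Psi(k)=\sum_{i=1}^k\frac{\varphi(i)}{i}=\frac{6}{\pi^2}k+O(\ln k).$$
   Context: A function $f:\{0,1,\dots,m\}\times\{0,1,\dots,n\}\to\{0,1\}$ is a (two-dimensional) threshold function if there exists a line $ax+by+c=0$ (with $a,b,c$ real and $(a,b)\neq(0,0)$) such that for all $(x,y)$ in the domain, $f(x,y)=0 \iff ax+by+c\le 0$. The estimates for $\Phi$ and $\Psi$ are known results from the literature, included in the statement.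
   Formalization: The first estimate, with error O(m^2 n ln n), is proved uniformly for m ≥ n ≥ 2 instead of m ≥ n ≥ 1: at n = 1 the error term is 0 while N(m,1) = 2m^2 + 8m + 4 differs from 6m^2/π^2. *)

theory Defs
  imports
    Complex_Main
    "HOL-Library.FuncSet"
    "HOL-Library.Landau_Symbols"
    "HOL-Number_Theory.Totient"
begin

definition grid :: "nat \<Rightarrow> nat \<Rightarrow> (nat \<times> nat) set" where
  "grid m n = {0..m} \<times> {0..n}"

(* Membership in the extensional function space makes distinct HOL functions correspond
   to distinct functions on the grid, so that they can be counted with card. *)
definition threshold_function :: "nat \<Rightarrow> nat \<Rightarrow> (nat \<times> nat \<Rightarrow> nat) \<Rightarrow> bool" where
  "threshold_function m n f \<longleftrightarrow>
     f \<in> grid m n \<rightarrow>\<^sub>E {0, 1} \<and>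
     (\<exists>a b c :: real. (a, b) \<noteq> (0, 0) \<and>
        (\<forall>(x, y) \<in> grid m n. f (x, y) = 0 \<longleftrightarrow> a * real x + b * real y + c \<le> 0))"

definition num_threshold :: "nat \<Rightarrow> nat \<Rightarrow> nat" where
  "num_threshold m n = card {f. threshold_function m n f}"

definition totient_sum :: "nat \<Rightarrow> nat" where
  "totient_sum k = (\<Sum>i = 1..k. totient i)"

definition totient_ratio_sum :: "nat \<Rightarrow> real" where
  "totient_ratio_sum k = (\<Sum>i = 1..k. real (totient i) / real i)"

(* Landau symbols along "principal (wide_grids k)" are uniform bounds: one constant serves
   all pairs (m, n) with m >= n >= k.  In particular n may stay bounded as m grows. *)
definition wide_grids :: "nat \<Rightarrow> (nat \<times> nat) set" where
  "wide_grids k = {(m, n). k \<le> n \<and> n \<le> m}"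

end

theory Submission
  imports Defs "HOL-Analysis.Gamma_Function" "HOL-Computational_Algebra.Squarefree"
begin

text \<open>
  A nonconstant threshold function determines exactly one of the two inner common tangents of its
  sets of zeros and of ones if we fix on which side of the directed tangent the zeros lie. On this
  tangent the zeros precede the ones, and the last zero and the first one are neighbouring lattice
  points, so that their difference is primitive. Conversely, every ordered pair of grid points with
  primitive difference arises from exactly one function. Hence \<open>N(m, n)\<close> is 2 plus the number of
  such pairs, that is,
  \<open>2 + 2 (2 m n + m + n) + 4 \<Sum> (m + 1 - i) (n + 1 - j)\<close>, summed over coprime \<open>i \<le> m\<close> and \<open>j \<le> n\<close>.
  For fixed \<open>j\<close>, Moebius inversion gives the number of \<open>i \<le> t\<close> coprime to \<open>j\<close> as \<open>t \<phi>(j) / j\<close> up to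
  the number of divisors of \<open>j\<close>. The averages of the totient are reduced to the sum of
  \<open>\<mu>(d) / d\<^sup>2\<close> over \<open>d \<le> k\<close>, which is \<open>6 / \<pi>\<^sup>2\<close> up to \<open>O(ln k / k)\<close>, because weighting the
  terms by the partial sums up to \<open>k / d\<close> of the series for \<open>\<zeta>(2)\<close> gives exactly 1.
\<close>

section \<open>Averages of the totient function\<close>

definition moebius_mu :: "nat \<Rightarrow> real" where
  "moebius_mu d = (if squarefree d then (-1) ^ card (prime_factors d) else 0)"

lemma abs_moebius_le_1: "\<bar>moebius_mu d\<bar> \<le> 1"
  by (simp add: moebius_mu_def)

lemma moebius_times_prime:
  assumes "prime p" "\<not> p dvd d" "squarefree d"
  shows "squarefree (p * d)" and "moebius_mu (p * d) = - moebius_mu d"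
proof -
  have cop: "coprime p d"
    using assms(1,2) by (simp add: prime_imp_coprime)
  have "d \<noteq> 0"
    using assms(2) by (metis dvd_0_right)
  show *: "squarefree (p * d)"
    using assms cop by (simp add: squarefree_mult_coprime squarefree_prime)
  have "prime_factors (p * d) = insert p (prime_factors d)"
    using \<open>d \<noteq> 0\<close> assms(1) by (subst prime_factors_product) (auto simp: prime_prime_factors)
  moreover have "p \<notin> prime_factors d"
    using assms(2) by auto
  ultimately show "moebius_mu (p * d) = - moebius_mu d"
    using * assms(3) by (simp add: moebius_mu_def)
qed

text \<open>For a prime \<open>p\<close> dividing \<open>n\<close>, the squarefree divisors of
  \<open>n\<close> are those not divisible by \<open>p\<close> together with \<open>p\<close> times
  these. Multiplying by \<open>p\<close> flips the sign of the summand, so the two halves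
  cancel.\<close>

lemma sum_moebius_divisors:
  assumes "n > 0"
  shows "(\<Sum>d | d dvd n. moebius_mu d) = (if n = 1 then 1 else 0)"
proof (cases "n = 1")
  case True
  then show ?thesis by (simp add: moebius_mu_def)
next
  case False
  then obtain p where p: "prime p" "p dvd n"
    using prime_factor_nat by blast
  have p0: "p > 0"
    using p(1) prime_gt_0_nat by blast
  define S where "S = {d. d dvd n \<and> squarefree d}"
  define S1 where "S1 = {d\<in>S. \<not> p dvd d}"
  have fin: "finite {d. d dvd n}"
    using assms by simp
  have finS: "finite S1"
    by (rule finite_subset[OF _ fin]) (auto simp: S1_def S_def)
  have S: "S = S1 \<union> (*) p ` S1"
  proof (intro equalityI subsetI)
    fix d assume d: "d \<in> S"
    show "d \<in> S1 \<union> (*) p ` S1"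
    proof (cases "p dvd d")
      case True
      then obtain e where e: "d = p * e" by blast
      have "\<not> p dvd e"
      proof
        assume "p dvd e"
        then have "p\<^sup>2 dvd d"
          by (auto simp: e power2_eq_square)
        then show False
          using d squarefreeD[of d p] p(1) by (auto simp: S_def)
      qed
      moreover have "e \<in> S"
        using d squarefree_multD[of p e] unfolding e S_def by (auto dest: dvd_mult_right)
      ultimately show ?thesis
        by (auto simp: e S1_def)
    qed (use d in \<open>auto simp: S1_def\<close>)
  next
    fix d assume "d \<in> S1 \<union> (*) p ` S1"
    then show "d \<in> S"
    proof
      assume "d \<in> (*) p ` S1"
      then obtain e where e: "d = p * e" "e \<in> S1" by blast
      have "coprime p e"
        using e p(1) by (auto simp: S1_def intro: prime_imp_coprime)
      then have "p * e dvd n"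
        using e p(2) by (intro divides_mult) (auto simp: S1_def S_def)
      then show ?thesis
        using e moebius_times_prime(1)[of p e] p(1) by (auto simp: S_def S1_def)
    qed (auto simp: S1_def)
  qed
  have "(\<Sum>d | d dvd n. moebius_mu d) = sum moebius_mu S"
    using fin by (intro sum.mono_neutral_right) (auto simp: S_def moebius_mu_def)
  also have "\<dots> = sum moebius_mu S1 + sum moebius_mu ((*) p ` S1)"
    unfolding S using finS by (intro sum.union_disjoint) (auto simp: S1_def)
  also have "sum moebius_mu ((*) p ` S1) = (\<Sum>d\<in>S1. moebius_mu (p * d))"
    using p0 by (subst sum.reindex) (auto simp: inj_on_def)
  also have "\<dots> = (\<Sum>d\<in>S1. - moebius_mu d)"
    using p(1) by (intro sum.cong refl moebius_times_prime(2)) (auto simp: S1_def S_def)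
  finally show ?thesis
    using False by (simp add: sum_negf)
qed

section \<open>Interchanging divisor sums and counting coprime integers\<close>

lemma multiples_atLeastAtMost:
  fixes d k :: nat
  assumes "d > 0"
  shows "{i\<in>{1..k}. d dvd i} = (*) d ` {1..k div d}"
proof (intro equalityI subsetI)
  fix i assume i: "i \<in> {i\<in>{1..k}. d dvd i}"
  then obtain e where e: "i = d * e" by blast
  have "e \<le> k div d"
    using i assms by (simp add: e less_eq_div_iff_mult_less_eq mult.commute)
  moreover have "e \<ge> 1"
    using i by (cases e) (auto simp: e)
  ultimately show "i \<in> (*) d ` {1..k div d}"
    by (auto simp: e)
next
  fix i assume "i \<in> (*) d ` {1..k div d}"
  then obtain e where e: "i = d * e" "e \<ge> 1" "e \<le> k div d"
    by (metis atLeastAtMost_iff imageE)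
  then have "d * e \<le> k"
    using assms by (simp add: less_eq_div_iff_mult_less_eq mult.commute)
  then show "i \<in> {i\<in>{1..k}. d dvd i}"
    using e assms by (auto simp: Suc_le_eq)
qed

lemma sum_multiples:
  fixes d k :: nat
  assumes "d > 0"
  shows "(\<Sum>i | i \<in> {1..k} \<and> d dvd i. g i) = (\<Sum>e = 1..k div d. g (d * e))"
proof -
  have "(\<Sum>i | i \<in> {1..k} \<and> d dvd i. g i) = sum g ((*) d ` {1..k div d})"
    using multiples_atLeastAtMost[OF assms, of k] by simp
  also have "\<dots> = (\<Sum>e = 1..k div d. g (d * e))"
    using assms by (subst sum.reindex) (auto simp: inj_on_def)
  finally show ?thesis .
qed

text \<open>Pairs with \<open>d\<close> dividing \<open>i\<close> are parametrised by
  \<open>i = d * e\<close>. The summand may depend on both \<open>d\<close> and \<open>i\<close>, so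
  that one interchange serves divisor counts, totients and inverse squares alike.\<close>

lemma sum_divisors_swap:
  fixes f :: "nat \<Rightarrow> nat \<Rightarrow> 'a :: comm_monoid_add"
  shows "(\<Sum>i = 1..k. \<Sum>d | d dvd i. f d i) = (\<Sum>d = 1..k. \<Sum>e = 1..k div d. f d (d * e))"
proof -
  have "(\<Sum>i = 1..k. \<Sum>d | d dvd i. f d i) = (\<Sum>i = 1..k. \<Sum>d | d \<in> {1..k} \<and> d dvd i. f d i)"
  proof (intro sum.cong refl)
    fix i :: nat assume i: "i \<in> {1..k}"
    show "{d. d dvd i} = {d. d \<in> {1..k} \<and> d dvd i}"
      using i by (auto dest: dvd_imp_le intro: dvd_pos_nat simp: Suc_le_eq)
  qed
  also have "\<dots> = (\<Sum>d = 1..k. \<Sum>i | i \<in> {1..k} \<and> d dvd i. f d i)"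
    by (rule sum.swap_restrict) auto
  also have "\<dots> = (\<Sum>d = 1..k. \<Sum>e = 1..k div d. f d (d * e))"
    by (intro sum.cong refl sum_multiples) auto
  finally show ?thesis .
qed

text \<open>Coprimality is detected by the sum of \<open>moebius_mu\<close> over the common divisors
  of \<open>i\<close> and \<open>j\<close>. After interchanging, each divisor \<open>d\<close> of
  \<open>j\<close> contributes its \<open>t div d\<close> multiples up to \<open>t\<close>.\<close>

lemma card_coprime_eq:
  assumes "j > 0"
  shows "real (card {i\<in>{1..t}. coprime i j}) = (\<Sum>d | d dvd j. moebius_mu d * real (t div d))"
proof -
  have "real (card {i\<in>{1..t}. coprime i j}) = (\<Sum>i = 1..t. if coprime i j then 1 else 0)"
    by (simp add: sum.If_cases Int_def conj_commute)
  also have "\<dots> = (\<Sum>i = 1..t. \<Sum>d | d \<in> {d. d dvd j} \<and> d dvd i. moebius_mu d)"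
  proof (intro sum.cong refl)
    fix i assume "i \<in> {1..t}"
    have "(\<Sum>d | d \<in> {d. d dvd j} \<and> d dvd i. moebius_mu d) = (\<Sum>d | d dvd gcd i j. moebius_mu d)"
      by (intro sum.cong refl) auto
    also have "\<dots> = (if gcd i j = 1 then 1 else 0)"
      using assms by (intro sum_moebius_divisors) auto
    finally show "(if coprime i j then 1 else 0) = (\<Sum>d | d \<in> {d. d dvd j} \<and> d dvd i. moebius_mu d)"
      by (simp add: coprime_iff_gcd_eq_1)
  qed
  also have "\<dots> = (\<Sum>d | d dvd j. \<Sum>i | i \<in> {1..t} \<and> d dvd i. moebius_mu d)"
    using assms by (intro sum.swap_restrict) auto
  also have "\<dots> = (\<Sum>d | d dvd j. moebius_mu d * real (t div d))"
  proof (intro sum.cong refl)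
    fix d assume "d \<in> {d. d dvd j}"
    then have "d > 0"
      using assms by (auto intro: dvd_pos_nat)
    then show "(\<Sum>i | i \<in> {1..t} \<and> d dvd i. moebius_mu d) = moebius_mu d * real (t div d)"
      by (subst sum_multiples) simp_all
  qed
  finally show ?thesis .
qed

text \<open>This is \<open>card_coprime_eq\<close> at \<open>t = j\<close>, where every quotient
  \<open>j div d\<close> is exact.\<close>

lemma totient_over_eq:
  assumes "j > 0"
  shows "real (totient j) / real j = (\<Sum>d | d dvd j. moebius_mu d / real d)"
proof -
  have "real (totient j) = real (card {i\<in>{1..j}. coprime i j})"
    by (auto simp: totient_def totatives_def intro!: arg_cong[where f = card])
  also have "\<dots> = (\<Sum>d | d dvd j. moebius_mu d * real (j div d))"
    by (rule card_coprime_eq[OF assms])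
  also have "\<dots> = (\<Sum>d | d dvd j. real j * (moebius_mu d / real d))"
    by (intro sum.cong refl) (auto simp: real_of_nat_div)
  finally show ?thesis
    using assms by (simp only: sum_distrib_left[symmetric]) simp
qed

lemma real_div_bounds:
  fixes k d :: nat
  assumes "d > 0"
  shows "real (k div d) \<le> real k / real d" "real k / real d < real (k div d) + 1"
proof -
  show "real (k div d) \<le> real k / real d"
    by (rule of_nat_div_le_of_nat)
  have "k < (k div d + 1) * d"
    using assms by (metis dividend_less_div_times mult.commute Suc_eq_plus1 mult_Suc add.commute)
  then have "real k < (real (k div d) + 1) * real d"
    by (metis of_nat_1 of_nat_add of_nat_less_iff of_nat_mult)
  then show "real k / real d < real (k div d) + 1"
    using assms by (simp add: divide_less_eq)
qed

text \<open>The main term is the exact count with each \<open>t div d\<close> replaced by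
  \<open>t / d\<close>, which costs at most 1 per divisor.\<close>

lemma card_coprime_approx:
  assumes "j > 0"
  shows "\<bar>real (card {i\<in>{1..t}. coprime i j}) - real t * (real (totient j) / real j)\<bar>
           \<le> real (card {d. d dvd j})"
proof -
  have "real (card {i\<in>{1..t}. coprime i j}) - real t * (real (totient j) / real j)
      = (\<Sum>d | d dvd j. moebius_mu d * (real (t div d) - real t / real d))"
    unfolding card_coprime_eq[OF assms] totient_over_eq[OF assms]
    by (simp add: sum_distrib_left sum_subtractf algebra_simps)
  also have "\<bar>\<dots>\<bar> \<le> (\<Sum>d | d dvd j. 1)"
  proof (rule order.trans[OF sum_abs], rule sum_mono)
    fix d assume "d \<in> {d. d dvd j}"
    then have "d > 0"
      using assms by (auto intro: dvd_pos_nat)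
    then have "\<bar>real (t div d) - real t / real d\<bar> \<le> 1"
      using real_div_bounds[of d t] by linarith
    then show "\<bar>moebius_mu d * (real (t div d) - real t / real d)\<bar> \<le> 1"
      using abs_moebius_le_1[of d] by (simp add: abs_mult mult_le_one)
  qed
  finally show ?thesis by simp
qed

section \<open>Harmonic numbers and truncated series for zeta(2) and its inverse\<close>

lemma harm_real: "harm n = (\<Sum>d = 1..n. 1 / real d)"
  by (simp add: harm_def inverse_eq_divide)

lemma harm_le_1_plus_ln: "n > 0 \<Longrightarrow> (harm n :: real) \<le> 1 + ln (real n)"
proof (induction n rule: nat_induct_non_zero)
  case (Suc n)
  have "(harm (Suc n) :: real) = harm n + 1 / real (Suc n)"
    by (simp add: harm_Suc inverse_eq_divide)
  \<comment> \<open>From \<open>ln x \<le> x - 1\<close> at \<open>x = n / (n + 1)\<close>.\<close>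
  moreover have "1 / real (Suc n) \<le> ln (real (Suc n)) - ln (real n)"
    using Suc.hyps ln_le_minus_one[of "real n / real (Suc n)"]
    by (simp add: ln_div field_simps)
  ultimately show ?case using Suc.IH by linarith
qed (simp add: harm_def)

text \<open>With the divisor as outer variable, the sum counts the multiples of each
  \<open>d\<close> up to \<open>n\<close>, of which there are at most \<open>n / d\<close>.\<close>

lemma sum_card_divisors_le: "(\<Sum>j = 1..n. real (card {d. d dvd j})) \<le> real n * harm n"
proof -
  have "(\<Sum>j = 1..n. real (card {d. d dvd j})) = (\<Sum>j = 1..n. \<Sum>d | d dvd j. 1)"
    by simp
  also have "\<dots> = (\<Sum>d = 1..n. real (n div d))"
    by (subst sum_divisors_swap) simp
  also have "\<dots> \<le> (\<Sum>d = 1..n. real n * (1 / real d))"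
    by (intro sum_mono) (use of_nat_div_le_of_nat in auto)
  finally show ?thesis
    by (simp add: harm_real sum_distrib_left)
qed

text \<open>The partial sums increase to zeta(2), while the partial sums plus \<open>1 / n\<close>
  decrease to the same limit by telescoping. Hence the limit lies between the two.\<close>

lemma zeta_2_partial_sum_approx:
  assumes "n > 0"
  shows "\<bar>pi\<^sup>2 / 6 - (\<Sum>e = 1..n. 1 / (real e)\<^sup>2)\<bar> \<le> 1 / real n"
proof -
  define Z where "Z n = (\<Sum>e = 1..n. 1 / (real e)\<^sup>2)" for n
  have lim: "Z \<longlonglongrightarrow> pi\<^sup>2 / 6"
  proof -
    have "Z n = (\<Sum>i<n. 1 / (real i + 1)\<^sup>2)" for n
      unfolding Z_def by (induction n) (auto simp: add_ac)
    then have "Z = (\<lambda>n. \<Sum>i<n. 1 / (real i + 1)\<^sup>2)" by blast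
    then show ?thesis
      using inverse_squares_sums by (simp add: sums_def add_ac)
  qed
  have "incseq Z"
    by (intro incseq_SucI) (simp add: Z_def)
  then have 1: "Z n \<le> pi\<^sup>2 / 6"
    using lim by (rule incseq_le)
  \<comment> \<open>The index is shifted because \<open>1 / 0 = 0\<close> would make the unshifted
    sequence jump upwards from index 0 to index 1.\<close>
  have "decseq (\<lambda>n. Z (Suc n) + 1 / real (Suc n))"
  proof (intro decseq_SucI)
    fix n
    have "1 / (real n + 2)\<^sup>2 \<le> 1 / ((real n + 1) * (real n + 2))"
      by (intro divide_left_mono) (auto simp: power2_eq_square intro!: mult_right_mono mult_pos_pos)
    also have "\<dots> = 1 / (real n + 1) - 1 / (real n + 2)"
      by (simp add: field_simps)
    finally show "Z (Suc (Suc n)) + 1 / real (Suc (Suc n)) \<le> Z (Suc n) + 1 / real (Suc n)"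
      by (simp add: Z_def add_ac)
  qed
  moreover have "(\<lambda>n. Z (Suc n) + 1 / real (Suc n)) \<longlonglongrightarrow> pi\<^sup>2 / 6 + 0"
    by (intro tendsto_add LIMSEQ_Suc[OF lim] LIMSEQ_Suc[OF lim_1_over_n])
  ultimately have "pi\<^sup>2 / 6 + 0 \<le> Z (Suc (n - 1)) + 1 / real (Suc (n - 1))"
    by (rule decseq_ge)
  then show ?thesis
    using 1 assms by (simp add: Z_def)
qed

text \<open>Writing \<open>i = d * e\<close> turns the sum of \<open>1 / i^2\<close> times the
  indicator of \<open>i = 1\<close> into the identity \<open>Z1\<close>. Replacing
  \<open>Z (k div d)\<close> there by its limit costs at most \<open>2 * d / k\<close>, which
  against the weight \<open>1 / d^2\<close> sums to \<open>2 * harm k / k\<close>.\<close>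

lemma moebius_squares_approx:
  assumes "k > 0"
  shows "\<bar>(\<Sum>d = 1..k. moebius_mu d / (real d)\<^sup>2) - 6 / pi\<^sup>2\<bar> \<le> 2 * harm k / real k"
proof -
  define A where "A = (\<Sum>d = 1..k. moebius_mu d / (real d)\<^sup>2)"
  define Z where "Z n = (\<Sum>e = 1..n. 1 / (real e)\<^sup>2)" for n
  have "1 = (\<Sum>i = 1..k. if i = 1 then 1 / (real i)\<^sup>2 else 0)"
    using assms by (simp add: sum.delta)
  also have "\<dots> = (\<Sum>i = 1..k. 1 / (real i)\<^sup>2 * (\<Sum>d | d dvd i. moebius_mu d))"
    by (intro sum.cong refl) (simp add: sum_moebius_divisors)
  also have "\<dots> = (\<Sum>i = 1..k. \<Sum>d | d dvd i. moebius_mu d / (real i)\<^sup>2)"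
    by (simp add: sum_distrib_left)
  also have "\<dots> = (\<Sum>d = 1..k. \<Sum>e = 1..k div d. moebius_mu d / (real (d * e))\<^sup>2)"
    by (rule sum_divisors_swap)
  also have "\<dots> = (\<Sum>d = 1..k. moebius_mu d / (real d)\<^sup>2 * Z (k div d))"
    by (simp add: Z_def sum_distrib_left power_mult_distrib)
  finally have Z1: "(\<Sum>d = 1..k. moebius_mu d / (real d)\<^sup>2 * Z (k div d)) = 1" by simp
  have "pi\<^sup>2 / 6 * A - 1 = (\<Sum>d = 1..k. moebius_mu d / (real d)\<^sup>2 * (pi\<^sup>2 / 6 - Z (k div d)))"
    unfolding Z1[symmetric] A_def by (simp add: sum_distrib_left sum_subtractf algebra_simps)
  also have "\<bar>\<dots>\<bar> \<le> (\<Sum>d = 1..k. 2 / real k * (1 / real d))"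
  proof (rule order.trans[OF sum_abs], rule sum_mono)
    fix d assume d: "d \<in> {1..k}"
    have q: "k div d \<ge> 1"
      using d by (simp add: Suc_le_eq div_greater_zero_iff)
    have "real k / real d < real (k div d) + 1"
      using d by (intro real_div_bounds) auto
    \<comment> \<open>Because \<open>k div d\<close> is at least 1, rounding loses at most a factor
      2; this is the 2 of the final bound.\<close>
    also have "\<dots> \<le> 2 * real (k div d)"
      using q by simp
    finally have "1 / real (k div d) \<le> 2 * real d / real k"
      using d q by (simp add: field_simps)
    then have "\<bar>pi\<^sup>2 / 6 - Z (k div d)\<bar> \<le> 2 * real d / real k"
      using zeta_2_partial_sum_approx[of "k div d"] q unfolding Z_def by linarith
    then have "\<bar>moebius_mu d\<bar> / (real d)\<^sup>2 * \<bar>pi\<^sup>2 / 6 - Z (k div d)\<bar> \<le> 1 / (real d)\<^sup>2 * (2 * real d / real k)"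
      using abs_moebius_le_1[of d] by (intro mult_mono divide_right_mono) auto
    also have "\<dots> = 2 / real k * (1 / real d)"
      using d by (simp add: field_simps power2_eq_square)
    finally show "\<bar>moebius_mu d / (real d)\<^sup>2 * (pi\<^sup>2 / 6 - Z (k div d))\<bar> \<le> 2 / real k * (1 / real d)"
      by (simp add: abs_mult)
  qed
  also have "\<dots> = 2 * harm k / real k"
    by (simp only: harm_real sum_distrib_left[symmetric]) simp
  finally have 1: "\<bar>pi\<^sup>2 / 6 * A - 1\<bar> \<le> 2 * harm k / real k" .
  \<comment> \<open>Dividing by zeta(2) does not enlarge the error, since \<open>6 / pi^2\<close> is
    at most 1.\<close>
  have "pi\<^sup>2 \<ge> 3\<^sup>2"
    using pi_gt3 by (intro power_mono) auto
  then have pi: "6 / pi\<^sup>2 \<le> 1" "pi\<^sup>2 > 0"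
    by (auto simp: divide_le_eq)
  have "A - 6 / pi\<^sup>2 = 6 / pi\<^sup>2 * (pi\<^sup>2 / 6 * A - 1)"
    by (simp add: field_simps)
  then have "\<bar>A - 6 / pi\<^sup>2\<bar> = 6 / pi\<^sup>2 * \<bar>pi\<^sup>2 / 6 * A - 1\<bar>"
    by (simp only: abs_mult) simp
  also have "\<dots> \<le> 1 * \<bar>pi\<^sup>2 / 6 * A - 1\<bar>"
    using pi by (intro mult_right_mono) auto
  finally show ?thesis
    using 1 by (simp add: A_def)
qed

section \<open>The averages of the totient and of its ratio\<close>

text \<open>Dropping the rounding in \<open>k div d\<close> costs \<open>harm k\<close>, and
  replacing the truncated sum \<open>A\<close> by its limit, multiplied by \<open>k\<close>, costs
  \<open>2 * harm k\<close>.\<close>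

lemma totient_ratio_sum_approx:
  assumes "k > 0"
  shows "\<bar>totient_ratio_sum k - 6 / pi\<^sup>2 * real k\<bar> \<le> 3 * harm k"
proof -
  define A where "A = (\<Sum>d = 1..k. moebius_mu d / (real d)\<^sup>2)"
  have "totient_ratio_sum k = (\<Sum>i = 1..k. \<Sum>d | d dvd i. moebius_mu d / real d)"
    unfolding totient_ratio_sum_def by (intro sum.cong refl totient_over_eq) auto
  also have "\<dots> = (\<Sum>d = 1..k. moebius_mu d / real d * real (k div d))"
    by (subst sum_divisors_swap) (simp add: mult.commute)
  finally have "totient_ratio_sum k - real k * A
      = (\<Sum>d = 1..k. moebius_mu d / real d * (real (k div d) - real k / real d))"
    by (simp add: A_def sum_distrib_left sum_subtractf algebra_simps power2_eq_square)
  also have "\<bar>\<dots>\<bar> \<le> (\<Sum>d = 1..k. 1 / real d)"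
  proof (rule order.trans[OF sum_abs], rule sum_mono)
    fix d assume "d \<in> {1..k}"
    then have "\<bar>real (k div d) - real k / real d\<bar> \<le> 1"
      using real_div_bounds[of d k] by auto
    then have "\<bar>moebius_mu d\<bar> / real d * \<bar>real (k div d) - real k / real d\<bar> \<le> 1 / real d * 1"
      using abs_moebius_le_1[of d] by (intro mult_mono divide_right_mono) auto
    then show "\<bar>moebius_mu d / real d * (real (k div d) - real k / real d)\<bar> \<le> 1 / real d"
      by (simp add: abs_mult)
  qed
  finally have 1: "\<bar>totient_ratio_sum k - real k * A\<bar> \<le> harm k"
    by (simp add: harm_real)
  have "\<bar>real k * A - real k * (6 / pi\<^sup>2)\<bar> = real k * \<bar>A - 6 / pi\<^sup>2\<bar>"
    by (simp only: abs_mult right_diff_distrib[symmetric] abs_of_nat)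
  also have "\<dots> \<le> real k * (2 * harm k / real k)"
    using moebius_squares_approx[OF assms] by (intro mult_left_mono) (auto simp: A_def)
  also have "\<dots> = 2 * harm k"
    using assms by simp
  finally show ?thesis
    using 1 by (simp add: mult.commute)
qed

text \<open>Here the inner sum over \<open>e\<close> is a triangular number. Comparing it with half
  the square of \<open>k / d\<close> and replacing \<open>A\<close> by its limit each cost
  \<open>k * harm k\<close>.\<close>

lemma totient_sum_approx:
  assumes "k > 0"
  shows "\<bar>real (totient_sum k) - 3 / pi\<^sup>2 * (real k)\<^sup>2\<bar> \<le> 2 * real k * harm k"
proof -
  define A where "A = (\<Sum>d = 1..k. moebius_mu d / (real d)\<^sup>2)"
  have "real (totient_sum k) = (\<Sum>i = 1..k. \<Sum>d | d dvd i. moebius_mu d / real d * real i)"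
    unfolding totient_sum_def of_nat_sum
  proof (intro sum.cong refl)
    fix i assume "i \<in> {1..k}"
    then show "real (totient i) = (\<Sum>d | d dvd i. moebius_mu d / real d * real i)"
      using totient_over_eq[of i] by (simp only: sum_distrib_right[symmetric]) (auto simp: divide_eq_eq)
  qed
  also have "\<dots> = (\<Sum>d = 1..k. \<Sum>e = 1..k div d. moebius_mu d / real d * real (d * e))"
    by (rule sum_divisors_swap)
  also have "\<dots> = (\<Sum>d = 1..k. moebius_mu d * (real (k div d) * (real (k div d) + 1) / 2))"
  proof (intro sum.cong refl)
    fix d assume "d \<in> {1..k}"
    then have "(\<Sum>e = 1..k div d. moebius_mu d / real d * real (d * e))
        = (\<Sum>e = 1..k div d. moebius_mu d * real e)"
      by (intro sum.cong) auto
    also have "\<dots> = moebius_mu d * (\<Sum>e = 1..k div d. real e)"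
      by (simp add: sum_distrib_left)
    also have "(\<Sum>e = 1..k div d. real e) = real (k div d) * (real (k div d) + 1) / 2"
      using double_gauss_sum_from_Suc_0[of "k div d", where 'a = real] by simp
    finally show "(\<Sum>e = 1..k div d. moebius_mu d / real d * real (d * e))
        = moebius_mu d * (real (k div d) * (real (k div d) + 1) / 2)" .
  qed
  finally have "real (totient_sum k) - (real k)\<^sup>2 / 2 * A = (\<Sum>d = 1..k.
      moebius_mu d * ((real (k div d) * (real (k div d) + 1) - (real k / real d)\<^sup>2) / 2))"
    by (simp add: A_def sum_distrib_left sum_subtractf algebra_simps power2_eq_square
        diff_divide_distrib)
  also have "\<bar>\<dots>\<bar> \<le> (\<Sum>d = 1..k. real k * (1 / real d))"
  proof (rule order.trans[OF sum_abs], rule sum_mono)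
    fix d assume d: "d \<in> {1..k}"
    define q where "q = real (k div d)"
    define x where "x = real k / real d"
    have q: "q \<ge> 0" "q \<le> x" "x - 1 \<le> q" "x \<ge> 1"
      using real_div_bounds[of d k] d by (auto simp: q_def x_def)
    \<comment> \<open>Since \<open>q\<close> is \<open>x\<close> rounded down,
      \<open>q * (q + 1)\<close> differs from \<open>x^2\<close> by at most
      \<open>x\<close>.\<close>
    have "q * (q + 1) \<le> x * (x + 1)" "(x - 1) * x \<le> q * (q + 1)"
      using q by (auto intro!: mult_mono)
    then have "\<bar>(q * (q + 1) - x\<^sup>2) / 2\<bar> \<le> x"
      using q by (simp add: abs_le_iff power2_eq_square algebra_simps)
    then have "\<bar>moebius_mu d\<bar> * \<bar>(q * (q + 1) - x\<^sup>2) / 2\<bar> \<le> 1 * x"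
      using abs_moebius_le_1[of d] by (intro mult_mono) auto
    then show "\<bar>moebius_mu d * ((real (k div d) * (real (k div d) + 1) - (real k / real d)\<^sup>2) / 2)\<bar>
        \<le> real k * (1 / real d)"
      by (simp add: q_def x_def abs_mult)
  qed
  finally have 1: "\<bar>real (totient_sum k) - (real k)\<^sup>2 / 2 * A\<bar> \<le> real k * harm k"
    by (simp add: harm_real sum_distrib_left)
  have "\<bar>(real k)\<^sup>2 / 2 * A - (real k)\<^sup>2 / 2 * (6 / pi\<^sup>2)\<bar> = (real k)\<^sup>2 / 2 * \<bar>A - 6 / pi\<^sup>2\<bar>"
    by (simp only: abs_mult right_diff_distrib[symmetric]) simp
  also have "\<dots> \<le> (real k)\<^sup>2 / 2 * (2 * harm k / real k)"
    using moebius_squares_approx[OF assms] by (intro mult_left_mono) (auto simp: A_def)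
  also have "\<dots> = real k * harm k"
    using assms by (simp add: power2_eq_square)
  finally show ?thesis
    using 1 by (simp add: mult.commute)
qed

section \<open>Threshold functions and primitive pairs\<close>

text \<open>The cross product of the vectors from \<open>p\<close> to \<open>q\<close> and from
  \<open>r\<close> to \<open>s\<close>. Coordinates become integers before subtraction, as truncated
  subtraction would lose the signs.\<close>

definition wedge :: "nat \<times> nat \<Rightarrow> nat \<times> nat \<Rightarrow> nat \<times> nat \<Rightarrow> nat \<times> nat \<Rightarrow> int" where
  "wedge p q r s = (int (fst q) - int (fst p)) * (int (snd s) - int (snd r))
                 - (int (snd q) - int (snd p)) * (int (fst s) - int (fst r))"

text \<open>The dot product of the same two vectors.\<close>

definition along :: "nat \<times> nat \<Rightarrow> nat \<times> nat \<Rightarrow> nat \<times> nat \<Rightarrow> nat \<times> nat \<Rightarrow> int" where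
  "along p q r s = (int (fst q) - int (fst p)) * (int (fst s) - int (fst r))
                 + (int (snd q) - int (snd p)) * (int (snd s) - int (snd r))"

text \<open>For distinct points this says that no lattice point lies strictly between them; equal
  points are excluded because 0 is not coprime to itself.\<close>

definition primitive_pair :: "nat \<times> nat \<Rightarrow> nat \<times> nat \<Rightarrow> bool" where
  "primitive_pair p q \<longleftrightarrow> coprime (int (fst q) - int (fst p)) (int (snd q) - int (snd p))"

definition primitive_pairs :: "nat \<Rightarrow> nat \<Rightarrow> ((nat \<times> nat) \<times> (nat \<times> nat)) set" where
  "primitive_pairs m n = {(p, q). p \<in> grid m n \<and> q \<in> grid m n \<and> primitive_pair p q}"

text \<open>The open half plane to the left of the line directed from \<open>p\<close> to
  \<open>q\<close>, together with the closed ray of that line that starts at \<open>p\<close> and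
  points away from \<open>q\<close>.\<close>

definition zero_side :: "nat \<times> nat \<Rightarrow> nat \<times> nat \<Rightarrow> nat \<times> nat \<Rightarrow> bool" where
  "zero_side p q x \<longleftrightarrow> wedge p q p x > 0 \<or> wedge p q p x = 0 \<and> along p q p x \<le> 0"

definition pair_function :: "nat \<Rightarrow> nat \<Rightarrow> (nat \<times> nat) \<times> (nat \<times> nat) \<Rightarrow> nat \<times> nat \<Rightarrow> nat" where
  "pair_function m n = (\<lambda>(p, q). restrict (\<lambda>x. if zero_side p q x then 0 else 1) (grid m n))"

lemma finite_grid [simp]: "finite (grid m n)"
  by (simp add: grid_def)

lemma primitive_pair_neq: "primitive_pair p q \<Longrightarrow> p \<noteq> q"
  by (auto simp: primitive_pair_def)

lemma along_self_pos:
  assumes "p \<noteq> q"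
  shows "along p q p q > 0"
proof -
  have "(int (fst q) - int (fst p)) \<noteq> 0 \<or> (int (snd q) - int (snd p)) \<noteq> 0"
    using assms by (auto simp: prod_eq_iff)
  then show ?thesis
    unfolding along_def by (simp add: sum_squares_gt_zero_iff)
qed

lemma zero_side_first [simp]: "zero_side p q p"
  by (simp add: zero_side_def wedge_def along_def)

lemma not_zero_side_second:
  assumes "p \<noteq> q"
  shows "\<not> zero_side p q q"
  using along_self_pos[OF assms] by (simp add: zero_side_def wedge_def)

text \<open>Adding a small multiple of the along-coordinate tilts the line through the two points so
  that it separates them, while no other lattice point off the line changes sides.\<close>

lemma threshold_pair_function:
  assumes "p \<noteq> q"
  shows "threshold_function m n (pair_function m n (p, q))"
proof -
  define v1 where "v1 = real (fst q) - real (fst p)"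
  define v2 where "v2 = real (snd q) - real (snd p)"
  \<comment> \<open>\<open>K\<close> exceeds every along-coordinate on the grid. As a nonzero
    \<open>wedge\<close> has absolute value at least 1, the term \<open>K * wedge\<close> decides
    the sign off the line.\<close>
  define K :: int where "K = 1 + (\<Sum>x\<in>grid m n. \<bar>along p q p x\<bar>)"
  define k where "k = real_of_int K"
  define a where "a = v1 + k * v2"
  define b where "b = v2 - k * v1"
  define c where "c = - a * real (fst p) - b * real (snd p)"
  have K: "\<bar>along p q p x\<bar> < K" if "x \<in> grid m n" for x
    unfolding K_def using that member_le_sum[of x "grid m n" "\<lambda>x. \<bar>along p q p x\<bar>"] by force
  have side: "zero_side p q x \<longleftrightarrow> along p q p x - K * wedge p q p x \<le> 0" if x: "x \<in> grid m n" for x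
  proof -
    have "K \<ge> 0" using K[OF x] by linarith
    consider "wedge p q p x > 0" | "wedge p q p x = 0" | "wedge p q p x < 0" by linarith
    then show ?thesis
    proof cases
      case 1
      then have "K * 1 \<le> K * wedge p q p x"
        using \<open>K \<ge> 0\<close> by (intro mult_left_mono) auto
      then show ?thesis
        using 1 K[OF x] by (auto simp: zero_side_def)
    next
      case 2
      then show ?thesis by (simp add: zero_side_def)
    next
      case 3
      then have "K * wedge p q p x \<le> K * (-1)"
        using \<open>K \<ge> 0\<close> by (intro mult_left_mono) auto
      then show ?thesis
        using 3 K[OF x] by (auto simp: zero_side_def)
    qed
  qed
  have L: "real_of_int (along p q p x - K * wedge p q p x) = a * real (fst x) + b * real (snd x) + c" for x
    by (simp add: along_def wedge_def a_def b_def c_def v1_def v2_def k_def algebra_simps)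
  have "(a, b) \<noteq> (0, 0)"
  proof
    assume "(a, b) = (0, 0)"
    then have "v1 + k * v2 = 0" "v2 = k * v1"
      by (auto simp: a_def b_def)
    then have "v1 * (1 + k\<^sup>2) = 0"
      by (simp add: algebra_simps power2_eq_square)
    moreover have "1 + k\<^sup>2 > 0"
      by (intro add_pos_nonneg) auto
    ultimately have "v1 = 0" "v2 = 0"
      using \<open>v2 = k * v1\<close> by auto
    then show False
      using assms by (simp add: v1_def v2_def prod_eq_iff)
  qed
  moreover have "pair_function m n (p, q) x = 0 \<longleftrightarrow> a * real (fst x) + b * real (snd x) + c \<le> 0"
    if "x \<in> grid m n" for x
    unfolding L[symmetric] of_int_le_0_iff side[OF that, symmetric]
    using that by (simp add: pair_function_def)
  moreover have "pair_function m n (p, q) \<in> grid m n \<rightarrow>\<^sub>E {0, 1}"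
    by (auto simp: pair_function_def)
  ultimately show ?thesis
    unfolding threshold_function_def by (intro conjI exI[of _ a] exI[of _ b] exI[of _ c]) auto
qed

section \<open>Uniqueness of the primitive pair\<close>

text \<open>The multiplier is \<open>x * c + y * d\<close> with Bezout coefficients \<open>x\<close>
  and \<open>y\<close> of \<open>a\<close> and \<open>b\<close>; primitivity is what makes it an
  integer.\<close>

lemma parallel_to_coprime:
  fixes a b c d :: int
  assumes "coprime a b" "a * d = b * c"
  obtains k where "c = k * a" "d = k * b"
proof -
  obtain x y where xy: "x * a + y * b = 1"
    using assms(1) bezout_int[of a b] by (auto simp: coprime_iff_gcd_eq_1)
  have "(x * c + y * d) * a = x * a * c + y * (a * d)"
    by (simp add: algebra_simps)
  also have "\<dots> = (x * a + y * b) * c"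
    unfolding assms(2) by (simp add: algebra_simps)
  finally have c: "c = (x * c + y * d) * a"
    by (simp add: xy)
  have "(x * c + y * d) * b = x * (b * c) + y * b * d"
    by (simp add: algebra_simps)
  also have "\<dots> = (x * a + y * b) * d"
    unfolding assms(2)[symmetric] by (simp add: algebra_simps)
  finally have "d = (x * c + y * d) * b"
    by (simp add: xy)
  with c show thesis by (rule that)
qed

text \<open>If two pairs have the same function, the ends of each lie weakly on opposite sides of the
  line through the other, so the wedge product of the two directions has both signs. Hence all
  four points are collinear, and along the common line the jump occurs at a single place.\<close>

lemma zero_side_unique:
  assumes prim: "primitive_pair p q" "primitive_pair p' q'"
  assumes sides: "zero_side p q p'" "\<not> zero_side p q q'" "zero_side p' q' p" "\<not> zero_side p' q' q"
  shows "p' = p \<and> q' = q"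
proof -
  define a where "a = int (fst q) - int (fst p)"
  define b where "b = int (snd q) - int (snd p)"
  define c where "c = int (fst q') - int (fst p')"
  define d where "d = int (snd q') - int (snd p')"
  define e where "e = int (fst p') - int (fst p)"
  define f where "f = int (snd p') - int (snd p)"
  have eqs: "int (fst q') - int (fst p) = c + e" "int (snd q') - int (snd p) = d + f"
    "int (fst q) - int (fst p') = a - e" "int (snd q) - int (snd p') = b - f"
    "int (fst p) - int (fst p') = - e" "int (snd p) - int (snd p') = - f"
    by (simp_all add: a_def b_def c_def d_def e_def f_def)
  have ab: "coprime a b" and cd: "coprime c d"
    using prim by (auto simp: primitive_pair_def a_def b_def c_def d_def)
  have w1: "a * f - b * e \<ge> 0" and w2: "a * (d + f) - b * (c + e) \<le> 0"
    and w3: "c * (- f) - d * (- e) \<ge> 0" and w4: "c * (b - f) - d * (a - e) \<le> 0"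
    using sides unfolding zero_side_def wedge_def eqs
    by (auto simp: a_def[symmetric] b_def[symmetric] c_def[symmetric] d_def[symmetric]
        e_def[symmetric] f_def[symmetric])
  \<comment> \<open>\<open>w1\<close> and \<open>w2\<close> give \<open>a * d \<le> b * c\<close>,
    while \<open>w3\<close> and \<open>w4\<close> give the converse; with equality,
    \<open>w1\<close> and \<open>w2\<close> pinch \<open>a * f - b * e\<close> to 0.\<close>
  have par: "a * d = b * c" and on: "a * f = b * e"
    using w1 w2 w3 w4 by (simp_all add: algebra_simps)
  obtain k where k: "c = k * a" "d = k * b"
    using parallel_to_coprime[OF ab par] .
  obtain t where t: "e = t * a" "f = t * b"
    using parallel_to_coprime[OF ab on] .
  have pos: "a * a + b * b > 0"
    using along_self_pos[OF primitive_pair_neq[OF prim(1)]] by (simp add: along_def a_def b_def)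
  have "wedge p q p p' = 0" "wedge p q p q' = 0"
    unfolding wedge_def eqs a_def[symmetric] b_def[symmetric] e_def[symmetric] f_def[symmetric]
    using par on by (simp_all add: algebra_simps)
  then have "along p q p p' \<le> 0" "along p q p q' > 0"
    using sides(1,2) by (auto simp: zero_side_def)
  then have "t * (a * a + b * b) \<le> 0" "(t + k) * (a * a + b * b) > 0"
    unfolding along_def eqs a_def[symmetric] b_def[symmetric] e_def[symmetric] f_def[symmetric]
    by (simp_all add: t k algebra_simps)
  \<comment> \<open>In units of the vector from \<open>p\<close> to \<open>q\<close>, measured from
    \<open>p\<close>, the point \<open>p'\<close> sits at \<open>t\<close> and \<open>q'\<close> at
    \<open>t + k\<close>.\<close>
  then have tk: "t \<le> 0" "t + k > 0"
    using pos by (auto simp: mult_le_0_iff zero_less_mult_iff)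
  \<comment> \<open>Primitivity of the second pair makes \<open>k\<close> a unit, and
    \<open>k > - t \<ge> 0\<close> excludes -1. Then \<open>-1 < t \<le> 0\<close> leaves only
    0.\<close>
  have "k dvd 1"
    using cd by (rule coprime_common_divisor) (auto simp: k)
  then have "k = 1" "t = 0"
    using tk by (auto simp: zdvd1_eq)
  then show ?thesis
    using k t by (auto simp: a_def b_def c_def d_def e_def f_def prod_eq_iff)
qed

lemma inj_on_pair_function: "inj_on (pair_function m n) (primitive_pairs m n)"
proof (rule inj_onI)
  fix z z' assume z: "z \<in> primitive_pairs m n" and z': "z' \<in> primitive_pairs m n"
  assume eq: "pair_function m n z = pair_function m n z'"
  obtain p q where pq: "z = (p, q)" by (cases z)
  obtain r s where rs: "z' = (r, s)" by (cases z')
  have side: "zero_side p q x = zero_side r s x" if "x \<in> grid m n" for x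
    using fun_cong[OF eq, of x] that by (simp add: pair_function_def pq rs split: if_splits)
  have prim: "primitive_pair p q" "primitive_pair r s"
    and "p \<in> grid m n" "q \<in> grid m n" "r \<in> grid m n" "s \<in> grid m n"
    using z z' by (auto simp: primitive_pairs_def pq rs)
  moreover have "\<not> zero_side p q q" "\<not> zero_side r s s"
    using prim by (auto dest: primitive_pair_neq not_zero_side_second)
  ultimately have "r = p \<and> s = q"
    using side[of p] side[of q] side[of r] side[of s] by (intro zero_side_unique) auto
  then show "z = z'" by (simp add: pq rs)
qed

section \<open>Every nonconstant threshold function comes from a primitive pair\<close>

text \<open>The pair realises the extreme direction from the zeros to the ones of the function
  (largest quotient of the components across and along the gradient of the separating functional),
  and among these it is a shortest one.\<close>

lemma extreme_pair:
  assumes fin: "finite A" "finite B" and ne: "A \<noteq> {}" "B \<noteq> {}"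
  assumes sep: "\<And>p. p \<in> A \<Longrightarrow> a * real (fst p) + b * real (snd p) + c \<le> 0"
    "\<And>q. q \<in> B \<Longrightarrow> a * real (fst q) + b * real (snd q) + c > 0"
  defines "l \<equiv> \<lambda>p q. a * (real (fst q) - real (fst p)) + b * (real (snd q) - real (snd p))"
  obtains p q where "p \<in> A" "q \<in> B"
    "\<And>r s. r \<in> A \<Longrightarrow> s \<in> B \<Longrightarrow> wedge p q r s \<le> 0"
    "\<And>r s. r \<in> A \<Longrightarrow> s \<in> B \<Longrightarrow> wedge p q r s = 0 \<Longrightarrow> l p q \<le> l r s"
proof -
  define rho where
    "rho p q = a * (real (snd q) - real (snd p)) - b * (real (fst q) - real (fst p))" for p q
  define ratio where "ratio = (\<lambda>(p, q). rho p q / l p q)"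
  have l_pos: "l p q > 0" if "p \<in> A" "q \<in> B" for p q
    using sep(1)[OF that(1)] sep(2)[OF that(2)] by (simp add: l_def algebra_simps)
  have nz: "a\<^sup>2 + b\<^sup>2 > 0"
  proof (rule ccontr)
    assume "\<not> a\<^sup>2 + b\<^sup>2 > 0"
    then have "a = 0" "b = 0" by (simp_all add: sum_power2_gt_zero_iff)
    then show False
      using l_pos ne by (auto simp: l_def)
  qed
  define M where "M = Max (ratio ` (A \<times> B))"
  define P where "P = {z \<in> A \<times> B. ratio z = M}"
  have "M \<in> ratio ` (A \<times> B)"
    unfolding M_def using fin ne by (intro Max_in) auto
  then have "P \<noteq> {}" "finite P"
    using fin by (auto simp: P_def)
  then obtain z where z: "z \<in> P" "\<And>y. y \<in> P \<Longrightarrow> (\<lambda>(p, q). l p q) z \<le> (\<lambda>(p, q). l p q) y"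
    using arg_min_least[of P _ "\<lambda>(p, q). l p q"] arg_min_if_finite(1)[of P "\<lambda>(p, q). l p q"] by blast
  obtain p q where pq: "z = (p, q)" by (cases z)
  have mem: "p \<in> A" "q \<in> B" and M: "ratio (p, q) = M"
    using z(1) by (auto simp: P_def pq)
  \<comment> \<open>\<open>l\<close> and \<open>rho\<close> are the dot products with the orthogonal
    vectors \<open>(a, b)\<close> and \<open>(- b, a)\<close>, a change of coordinates of
    determinant \<open>a^2 + b^2\<close>. So the sign of \<open>wedge\<close> compares two values of
    \<open>ratio\<close>.\<close>
  have wedge: "(a\<^sup>2 + b\<^sup>2) * real_of_int (wedge p q r s) = l p q * rho r s - rho p q * l r s" for r s
    by (simp add: wedge_def l_def rho_def algebra_simps power2_eq_square)
  have le: "l p q * rho r s \<le> rho p q * l r s" if "r \<in> A" "s \<in> B" for r s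
  proof -
    have "ratio (r, s) \<le> M"
      unfolding M_def using that fin by (intro Max_ge) auto
    then show ?thesis
      using l_pos[OF that] l_pos[OF mem] M by (simp add: ratio_def field_simps)
  qed
  show thesis
  proof (rule that[OF mem])
    fix r s assume rs: "r \<in> A" "s \<in> B"
    have "(a\<^sup>2 + b\<^sup>2) * real_of_int (wedge p q r s) \<le> 0"
      using le[OF rs] unfolding wedge by simp
    then show "wedge p q r s \<le> 0"
      using nz by (simp add: mult_le_0_iff)
    assume "wedge p q r s = 0"
    then have "rho r s / l r s = rho p q / l p q"
      using wedge[of r s] l_pos[OF rs] l_pos[OF mem] by (simp add: field_simps)
    then have "(r, s) \<in> P"
      using rs M by (simp add: P_def ratio_def)
    then show "l p q \<le> l r s"
      using z(2)[of "(r, s)"] by (simp add: pq)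
  qed
qed

text \<open>Dividing the difference vector by its gcd \<open>g\<close> gives the step from
  \<open>p\<close> to \<open>z\<close>. Each coordinate of \<open>z\<close> lies between those of
  \<open>p\<close> and \<open>q\<close>, so \<open>z\<close> stays in the grid.\<close>

lemma nonprimitive_intermediate_point:
  assumes "p \<in> grid m n" "q \<in> grid m n" "p \<noteq> q" "\<not> primitive_pair p q"
  obtains z g where "z \<in> grid m n" "g > 1"
    "int (fst q) - int (fst p) = g * (int (fst z) - int (fst p))"
    "int (snd q) - int (snd p) = g * (int (snd z) - int (snd p))"
proof -
  define v1 where "v1 = int (fst q) - int (fst p)"
  define v2 where "v2 = int (snd q) - int (snd p)"
  define g where "g = gcd v1 v2"
  obtain w1 w2 where w: "v1 = g * w1" "v2 = g * w2"
    unfolding g_def by (meson dvd_def gcd_dvd1 gcd_dvd2)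
  have "v1 \<noteq> 0 \<or> v2 \<noteq> 0"
    using assms(3) by (auto simp: v1_def v2_def prod_eq_iff)
  then have "g > 0"
    by (simp add: g_def gcd_pos_int)
  moreover have "g \<noteq> 1"
    using assms(4) by (simp add: primitive_pair_def g_def v1_def v2_def coprime_iff_gcd_eq_1)
  ultimately have g: "g > 1" by simp
  have between: "0 \<le> int x + w \<and> int x + w \<le> int N"
    if "x \<le> N" "y \<le> N" "int y - int x = g * w" for x y N w
  proof (cases "w \<ge> 0")
    case True
    then have "1 * w \<le> g * w"
      using g by (intro mult_right_mono) auto
    then show ?thesis
      using that True by linarith
  next
    case False
    then have "g * w \<le> 1 * w"
      using g by (intro mult_right_mono_neg) auto
    then show ?thesis
      using that False by linarith
  qed
  have b: "0 \<le> int (fst p) + w1 \<and> int (fst p) + w1 \<le> int m"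
    "0 \<le> int (snd p) + w2 \<and> int (snd p) + w2 \<le> int n"
    using between[of "fst p" m "fst q" w1] between[of "snd p" n "snd q" w2] assms(1,2) w
    by (auto simp: grid_def v1_def v2_def)
  show thesis
  proof (rule that[of "(nat (int (fst p) + w1), nat (int (snd p) + w2))" g])
    show "(nat (int (fst p) + w1), nat (int (snd p) + w2)) \<in> grid m n"
      using b by (auto simp: grid_def nat_le_iff)
  qed (use b g w in \<open>simp_all add: v1_def v2_def\<close>)
qed

text \<open>The pair is the one from \<open>extreme_pair\<close> for the sets of zeros and ones.
  Extremality settles the points off its line, and minimality of \<open>l\<close> gives primitivity
  and settles the points on the line.\<close>

lemma threshold_function_is_pair_function:
  assumes f: "threshold_function m n f"
  assumes nonconst: "\<exists>x\<in>grid m n. f x = 0" "\<exists>x\<in>grid m n. f x \<noteq> 0"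
  shows "f \<in> pair_function m n ` primitive_pairs m n"
proof -
  obtain a b c where fE: "f \<in> grid m n \<rightarrow>\<^sub>E {0, 1}"
    and abc: "\<And>x. x \<in> grid m n \<Longrightarrow> f x = 0 \<longleftrightarrow> a * real (fst x) + b * real (snd x) + c \<le> 0"
    using f unfolding threshold_function_def by fastforce
  define A where "A = {x\<in>grid m n. f x = 0}"
  define B where "B = {x\<in>grid m n. f x \<noteq> 0}"
  define l where "l p q = a * (real (fst q) - real (fst p)) + b * (real (snd q) - real (snd p))" for p q
  have AB: "finite A" "finite B" "A \<noteq> {}" "B \<noteq> {}"
    using nonconst by (auto simp: A_def B_def)
  have sepA: "a * real (fst p) + b * real (snd p) + c \<le> 0" if "p \<in> A" for p
    using that abc[of p] by (auto simp: A_def)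
  have sepB: "a * real (fst q) + b * real (snd q) + c > 0" if "q \<in> B" for q
    using that abc[of q] by (auto simp: B_def)
  obtain p q where pq: "p \<in> A" "q \<in> B"
    and ext: "\<And>r s. r \<in> A \<Longrightarrow> s \<in> B \<Longrightarrow> wedge p q r s \<le> 0"
    and least: "\<And>r s. r \<in> A \<Longrightarrow> s \<in> B \<Longrightarrow> wedge p q r s = 0 \<Longrightarrow> l p q \<le> l r s"
    unfolding l_def by (rule extreme_pair[OF AB sepA sepB]) blast+
  have l_pos: "l p q > 0"
    using sepA[OF pq(1)] sepB[OF pq(2)] by (simp add: l_def algebra_simps)
  have grid: "p \<in> grid m n" "q \<in> grid m n" and neq: "p \<noteq> q"
    using pq by (auto simp: A_def B_def)
  \<comment> \<open>An intermediate point \<open>z\<close> would be a zero or a one, so that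
    \<open>(z, q)\<close> or \<open>(p, z)\<close> would be a competing pair in the same direction
    with smaller \<open>l\<close>.\<close>
  have prim: "primitive_pair p q"
  proof (rule ccontr)
    assume "\<not> primitive_pair p q"
    then obtain z g where z: "z \<in> grid m n" and g: "g > 1"
      and dx: "int (fst q) - int (fst p) = g * (int (fst z) - int (fst p))"
      and dy: "int (snd q) - int (snd p) = g * (int (snd z) - int (snd p))"
      using nonprimitive_intermediate_point[OF grid neq] by metis
    have dx': "real (fst q) - real (fst p) = g * (real (fst z) - real (fst p))"
      using arg_cong[OF dx, of real_of_int] by simp
    have dy': "real (snd q) - real (snd p) = g * (real (snd z) - real (snd p))"
      using arg_cong[OF dy, of real_of_int] by simp
    have lg: "l p q = g * l p z"
      unfolding l_def dx' dy' by (simp add: algebra_simps)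
    then have "l p z > 0"
      using l_pos g by (simp add: zero_less_mult_iff)
    then have "l p z < l p q"
      using g unfolding lg by simp
    moreover have "l p z + l z q = l p q"
      by (simp add: l_def algebra_simps)
    moreover have "wedge p q p z = 0"
      unfolding wedge_def dx dy by (simp add: algebra_simps)
    moreover have "wedge p q z q = - wedge p q p z"
      by (simp add: wedge_def algebra_simps)
    moreover have "z \<in> A \<or> z \<in> B"
      using z by (auto simp: A_def B_def)
    ultimately show False
      using least[of z q] least[of p z] pq \<open>l p z > 0\<close> by auto
  qed
  have side: "zero_side p q x \<longleftrightarrow> f x = 0" if x: "x \<in> grid m n" for x
  proof -
    \<comment> \<open>On the line, both \<open>along\<close> and \<open>l\<close> from
      \<open>p\<close> are proportional to the displacement and positive at \<open>q\<close>, so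
      their signs agree.\<close>
    have along: "l p q * along p q p x = l p x * along p q p q" if "wedge p q p x = 0"
    proof -
      have w: "(real (fst q) - real (fst p)) * (real (snd x) - real (snd p))
          = (real (snd q) - real (snd p)) * (real (fst x) - real (fst p))"
        using arg_cong[OF that, of real_of_int] by (simp add: wedge_def)
      show ?thesis
        using w unfolding l_def along_def by simp algebra
    qed
    have app: "real_of_int (along p q p q) > 0"
      using along_self_pos[OF neq] by simp
    show ?thesis
    proof (cases "f x = 0")
      case True
      then have xA: "x \<in> A" using x by (simp add: A_def)
      have sw: "wedge p q x q = - wedge p q p x"
        by (simp add: wedge_def algebra_simps)
      \<comment> \<open>Minimality against the pair \<open>(x, q)\<close> forbids a zero
        \<open>x\<close> beyond \<open>p\<close>.\<close>
      have "along p q p x \<le> 0" if w: "wedge p q p x = 0"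
      proof -
        have "l p q \<le> l x q"
          using least[OF xA pq(2)] w sw by simp
        then have "l p x \<le> 0"
          by (simp add: l_def algebra_simps)
        then have "l p q * along p q p x \<le> 0"
          unfolding along[OF w] using app by (simp add: mult_le_0_iff)
        then show ?thesis
          using l_pos by (simp add: mult_le_0_iff)
      qed
      then show ?thesis
        using ext[OF xA pq(2)] sw True by (auto simp: zero_side_def)
    next
      case False
      then have xB: "x \<in> B" using x by (simp add: B_def)
      have "along p q p x > 0" if w: "wedge p q p x = 0"
      proof -
        have "l p x > 0"
          using least[OF pq(1) xB w] l_pos by simp
        then have "l p q * along p q p x > 0"
          unfolding along[OF w] using app by simp
        then show ?thesis
          using l_pos by (simp add: zero_less_mult_iff)
      qed
      then show ?thesis
        using ext[OF pq(1) xB] False by (auto simp: zero_side_def)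
    qed
  qed
  have "f = pair_function m n (p, q)"
  proof
    fix x
    show "f x = pair_function m n (p, q) x"
    proof (cases "x \<in> grid m n")
      case True
      then have "f x \<in> {0, 1}"
        using fE by auto
      then show ?thesis
        using True side[OF True] by (auto simp: pair_function_def)
    qed (use fE in \<open>auto simp: pair_function_def\<close>)
  qed
  then show ?thesis
    using grid prim by (auto simp: primitive_pairs_def)
qed

text \<open>The summand 2 stands for the two constant functions; a pair function is never constant,
  being 0 at \<open>p\<close> and 1 at \<open>q\<close>.\<close>

lemma num_threshold_eq: "num_threshold m n = card (primitive_pairs m n) + 2"
proof -
  define c0 where "c0 = (\<lambda>x\<in>grid m n. 0 :: nat)"
  define c1 where "c1 = (\<lambda>x\<in>grid m n. 1 :: nat)"
  have o: "(0, 0) \<in> grid m n" by (simp add: grid_def)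
  have fin: "finite (primitive_pairs m n)"
    by (rule finite_subset[of _ "grid m n \<times> grid m n"]) (auto simp: primitive_pairs_def)
  have "threshold_function m n c0"
    unfolding threshold_function_def
    by (intro conjI exI[of _ "1::real"] exI[of _ "0::real"] exI[of _ "- real m"])
      (auto simp: c0_def grid_def)
  moreover have "threshold_function m n c1"
    unfolding threshold_function_def
    by (intro conjI exI[of _ "1::real"] exI[of _ "0::real"]) (auto simp: c1_def grid_def)
  moreover have "threshold_function m n (pair_function m n z)" if "z \<in> primitive_pairs m n" for z
    using that threshold_pair_function[of "fst z" "snd z"] primitive_pair_neq[of "fst z" "snd z"]
    by (auto simp: primitive_pairs_def)
  moreover have "f \<in> insert c0 (insert c1 (pair_function m n ` primitive_pairs m n))"
    if f: "threshold_function m n f" for f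
  proof -
    have fE: "f \<in> grid m n \<rightarrow>\<^sub>E {0, 1}"
      using f by (simp add: threshold_function_def)
    show ?thesis
    proof (cases "(\<exists>x\<in>grid m n. f x = 0) \<and> (\<exists>x\<in>grid m n. f x \<noteq> 0)")
      case True
      then show ?thesis
        using threshold_function_is_pair_function[OF f] by blast
    next
      case False
      then consider "\<forall>x\<in>grid m n. f x = 0" | "\<forall>x\<in>grid m n. f x = 1"
        using fE by (fastforce simp: PiE_iff)
      then have "f = c0 \<or> f = c1"
      proof cases
        case 1
        then have "f = c0"
          using fE by (intro ext) (auto simp: c0_def PiE_iff extensional_def)
        then show ?thesis ..
      next
        case 2
        then have "f = c1"
          using fE by (intro ext) (auto simp: c1_def PiE_iff extensional_def)
        then show ?thesis ..
      qed
      then show ?thesis by blast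
    qed
  qed
  ultimately have "{f. threshold_function m n f}
      = insert c0 (insert c1 (pair_function m n ` primitive_pairs m n))"
    by blast
  moreover have "c0 \<noteq> c1"
    using o by (auto simp: c0_def c1_def fun_eq_iff)
  moreover have "pair_function m n z \<notin> {c0, c1}" if "z \<in> primitive_pairs m n" for z
  proof -
    obtain p q where z: "z = (p, q)" by (cases z)
    have "p \<in> grid m n" "q \<in> grid m n" "p \<noteq> q"
      using that by (auto simp: z primitive_pairs_def dest: primitive_pair_neq)
    then have "pair_function m n z p = 0" "c1 p = 1" "pair_function m n z q = 1" "c0 q = 0"
      using not_zero_side_second by (auto simp: z pair_function_def c0_def c1_def)
    then show ?thesis
      by auto
  qed
  then have "c0 \<notin> pair_function m n ` primitive_pairs m n"
    "c1 \<notin> pair_function m n ` primitive_pairs m n"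
    by blast+
  ultimately show ?thesis
    using fin inj_on_pair_function[of m n] by (simp add: num_threshold_def card_image)
qed

section \<open>Counting primitive pairs\<close>

text \<open>Among the ordered pairs from \<open>{0..m}\<close>, \<open>m + 1\<close> have distance 0
  and \<open>2 * (m + 1 - i)\<close> have distance \<open>i > 0\<close>. The induction step adds a
  row, a column and their common corner.\<close>

lemma sum_abs_diff:
  fixes g :: "nat \<Rightarrow> real"
  shows "(\<Sum>x\<le>m. \<Sum>y\<le>m. g (nat \<bar>int y - int x\<bar>))
           = (real m + 1) * g 0 + 2 * (\<Sum>i = 1..m. (real m + 1 - real i) * g i)"
proof (induction m)
  case (Suc m)
  have shift: "(\<Sum>x\<le>m. g (Suc m - x)) = (\<Sum>i = 1..Suc m. g i)"
    by (rule sum.reindex_bij_witness[of _ "\<lambda>i. Suc m - i" "\<lambda>x. Suc m - x"]) auto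
  have row: "(\<Sum>x\<le>m. g (nat \<bar>int (Suc m) - int x\<bar>)) = (\<Sum>i = 1..Suc m. g i)"
    "(\<Sum>x\<le>m. g (nat \<bar>int x - int (Suc m)\<bar>)) = (\<Sum>i = 1..Suc m. g i)"
    unfolding shift[symmetric] by (auto intro!: sum.cong arg_cong[where f = g])
  have "(\<Sum>x\<le>Suc m. \<Sum>y\<le>Suc m. g (nat \<bar>int y - int x\<bar>))
      = (\<Sum>x\<le>m. \<Sum>y\<le>m. g (nat \<bar>int y - int x\<bar>)) + 2 * (\<Sum>i = 1..Suc m. g i) + g 0"
    unfolding sum.atMost_Suc sum.distrib row by simp
  also have "\<dots> = (real (Suc m) + 1) * g 0
      + 2 * ((\<Sum>i = 1..m. (real m + 1 - real i) * g i) + (\<Sum>i = 1..Suc m. g i))"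
    unfolding Suc.IH by (simp add: algebra_simps)
  also have "(\<Sum>i = 1..m. (real m + 1 - real i) * g i) + (\<Sum>i = 1..Suc m. g i)
      = (\<Sum>i = 1..Suc m. (real (Suc m) + 1 - real i) * g i)"
    by (simp add: sum.distrib[symmetric] algebra_simps)
  finally show ?case .
qed simp

text \<open>Primitivity depends only on the absolute coordinate differences, so
  \<open>sum_abs_diff\<close> applies once to each coordinate. The terms outside the factor 4 are
  the horizontal and vertical pairs.\<close>

lemma card_primitive_pairs:
  assumes "m > 0" "n > 0"
  shows "real (card (primitive_pairs m n)) = 2 * (2 * real m * real n + real m + real n)
    + 4 * (\<Sum>j = 1..n. (real n + 1 - real j) *
            (\<Sum>i = 1..m. (real m + 1 - real i) * of_bool (coprime i j)))"
proof -
  define h where "h i j = (of_bool (coprime i j) :: real)" for i j :: nat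
  \<comment> \<open>Only 1 is coprime to 0, so axis-parallel primitive pairs are neighbours.\<close>
  have h0: "(\<Sum>j = 1..n. (real n + 1 - real j) * h 0 j) = real n" if "n > 0" for n
  proof -
    have "(\<Sum>j = 1..n. (real n + 1 - real j) * h 0 j)
        = (\<Sum>j = 1..n. if j = 1 then real n + 1 - real j else 0)"
      by (intro sum.cong) (auto simp: h_def)
    then show ?thesis
      using that by (simp add: sum.delta)
  qed
  have swap: "h i j = h j i" for i j
    by (simp add: h_def coprime_commute)
  have prim: "of_bool (primitive_pair (x1, y1) (x2, y2))
      = h (nat \<bar>int x2 - int x1\<bar>) (nat \<bar>int y2 - int y1\<bar>)" for x1 y1 x2 y2
    by (simp add: h_def primitive_pair_def)
  have "real (card (primitive_pairs m n))
      = (\<Sum>z\<in>grid m n \<times> grid m n. of_bool (primitive_pair (fst z) (snd z)))"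
  proof -
    have "primitive_pairs m n = (grid m n \<times> grid m n) \<inter> {z. primitive_pair (fst z) (snd z)}"
      by (auto simp: primitive_pairs_def)
    then show ?thesis
      by (simp add: of_bool_def sum.If_cases)
  qed
  also have "\<dots> = (\<Sum>p\<in>grid m n. \<Sum>q\<in>grid m n. of_bool (primitive_pair p q))"
    by (simp only: sum.cartesian_product case_prod_unfold)
  also have "\<dots> = (\<Sum>x1\<le>m. \<Sum>y1\<le>n. \<Sum>x2\<le>m. \<Sum>y2\<le>n.
      of_bool (primitive_pair (x1, y1) (x2, y2)))"
  proof -
    have "sum g (grid m n) = (\<Sum>x\<le>m. \<Sum>y\<le>n. g (x, y))" for g :: "nat \<times> nat \<Rightarrow> real"
      by (simp only: grid_def atLeast0AtMost sum.cartesian_product case_prod_unfold prod.collapse)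
    then show ?thesis by simp
  qed
  also have "\<dots> = (\<Sum>x1\<le>m. \<Sum>x2\<le>m. \<Sum>y1\<le>n. \<Sum>y2\<le>n.
      h (nat \<bar>int x2 - int x1\<bar>) (nat \<bar>int y2 - int y1\<bar>))"
    unfolding prim by (intro sum.cong refl sum.swap)
  also have "\<dots> = (\<Sum>x1\<le>m. \<Sum>x2\<le>m. (real n + 1) * h (nat \<bar>int x2 - int x1\<bar>) 0
      + 2 * (\<Sum>j = 1..n. (real n + 1 - real j) * h (nat \<bar>int x2 - int x1\<bar>) j))"
    by (simp only: sum_abs_diff)
  also have "\<dots> = (real m + 1) * ((real n + 1) * h 0 0 + 2 * (\<Sum>j = 1..n. (real n + 1 - real j) * h 0 j))
      + 2 * (\<Sum>i = 1..m. (real m + 1 - real i) * ((real n + 1) * h i 0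
        + 2 * (\<Sum>j = 1..n. (real n + 1 - real j) * h i j)))"
    by (rule sum_abs_diff)
  also have "\<dots> = (real m + 1) * (2 * real n) + 2 * ((real n + 1) * real m)
      + 4 * (\<Sum>i = 1..m. \<Sum>j = 1..n. (real m + 1 - real i) * ((real n + 1 - real j) * h i j))"
  proof -
    have "h 0 0 = 0" by (simp add: h_def)
    moreover have "(\<Sum>i = 1..m. (real m + 1 - real i) * (c * h i 0
        + 2 * (\<Sum>j = 1..n. (real n + 1 - real j) * h i j)))
      = c * (\<Sum>i = 1..m. (real m + 1 - real i) * h 0 i)
      + 2 * (\<Sum>i = 1..m. \<Sum>j = 1..n. (real m + 1 - real i) * ((real n + 1 - real j) * h i j))" for c
      by (simp only: sum_distrib_left sum.distrib[symmetric] swap[of _ 0] distrib_left mult_ac)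
    ultimately show ?thesis
      unfolding h0[OF assms(1)] h0[OF assms(2)] by simp
  qed
  also have "(\<Sum>i = 1..m. \<Sum>j = 1..n. (real m + 1 - real i) * ((real n + 1 - real j) * h i j))
      = (\<Sum>j = 1..n. (real n + 1 - real j) * (\<Sum>i = 1..m. (real m + 1 - real i) * h i j))"
    by (subst sum.swap) (simp only: sum_distrib_left mult_ac)
  finally show ?thesis
    by (simp add: h_def algebra_simps)
qed

section \<open>From the exact count to the approximation by Psi and Phi\<close>

text \<open>Summation by parts: the weight \<open>m + 1 - i\<close> counts the \<open>t\<close> with
  \<open>i \<le> t \<le> m\<close>. The sum is thus a sum over \<open>t\<close> of the counts in
  \<open>card_coprime_approx\<close>, each with the same error.\<close>

lemma sum_coprime_weighted_approx:
  assumes "j > 0"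
  shows "\<bar>(\<Sum>i = 1..m. (real m + 1 - real i) * of_bool (coprime i j))
           - real m * (real m + 1) / 2 * (real (totient j) / real j)\<bar>
         \<le> real m * real (card {d. d dvd j})"
proof -
  define c where "c t = real (card {i\<in>{1..t}. coprime i j})" for t
  define \<rho> where "\<rho> = real (totient j) / real j"
  define h where "h i = (of_bool (coprime i j) :: real)" for i
  have c: "c t = (\<Sum>i = 1..t. h i)" for t
    by (simp add: c_def h_def of_bool_def sum.If_cases Int_def conj_commute)
  have "(\<Sum>i = 1..m. (real m + 1 - real i) * h i) = (\<Sum>t = 1..m. c t)"
  proof (induction m)
    case (Suc m)
    have "(\<Sum>i = 1..Suc m. (real (Suc m) + 1 - real i) * h i)
        = (\<Sum>i = 1..m. (real m + 1 - real i) * h i) + c (Suc m)"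
      by (simp add: c sum.distrib[symmetric] algebra_simps)
    then show ?case
      using Suc.IH by simp
  qed simp
  then have "(\<Sum>i = 1..m. (real m + 1 - real i) * of_bool (coprime i j)) = (\<Sum>t = 1..m. c t)"
    by (simp only: h_def)
  moreover have "real m * (real m + 1) / 2 = (\<Sum>t = 1..m. real t)"
    using double_gauss_sum_from_Suc_0[of m, where 'a = real] by simp
  ultimately have "(\<Sum>i = 1..m. (real m + 1 - real i) * of_bool (coprime i j))
      - real m * (real m + 1) / 2 * \<rho> = (\<Sum>t = 1..m. c t - real t * \<rho>)"
    by (simp only: sum_subtractf sum_distrib_right)
  also have "\<bar>\<dots>\<bar> \<le> (\<Sum>t = 1..m. real (card {d. d dvd j}))"
    using card_coprime_approx[OF assms]
    by (intro order.trans[OF sum_abs] sum_mono) (auto simp: c_def \<rho>_def)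
  finally show ?thesis
    by (simp add: \<rho>_def)
qed

text \<open>The divisor sum is kept in the error because the two asymptotics bound it differently:
  by \<open>n * harm n\<close> for the first and by \<open>n^2\<close> for the second.\<close>

lemma num_threshold_approx:
  assumes "m > 0" "n > 0"
  shows "\<bar>real (num_threshold m n)
           - 2 * ((real n + 1) * totient_ratio_sum n - real (totient_sum n)) * real m ^ 2\<bar>
         \<le> 12 * real m * real n ^ 2 + 4 * real m * real n * (\<Sum>j = 1..n. real (card {d. d dvd j}))"
proof -
  define W where "W = (real n + 1) * totient_ratio_sum n - real (totient_sum n)"
  define E where "E = (\<Sum>j = 1..n. real (card {d. d dvd j}))"
  define S where "S j = (\<Sum>i = 1..m. (real m + 1 - real i) * of_bool (coprime i j))" for j
  define T where "T = (\<Sum>j = 1..n. (real n + 1 - real j) * S j)"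
  have N: "real (num_threshold m n) = 2 + 2 * (2 * real m * real n + real m + real n) + 4 * T"
    using card_primitive_pairs[OF assms] by (simp add: num_threshold_eq T_def S_def)
  have W: "W = (\<Sum>j = 1..n. (real n + 1 - real j) * (real (totient j) / real j))"
    unfolding W_def totient_ratio_sum_def totient_sum_def of_nat_sum sum_distrib_left
      sum_subtractf[symmetric]
    by (intro sum.cong refl) (auto simp: field_simps)
  have W_bounds: "0 \<le> W" "W \<le> real n * real n"
  proof -
    show "0 \<le> W"
      unfolding W by (intro sum_nonneg mult_nonneg_nonneg) auto
    have "W \<le> (\<Sum>j = 1..n. real n * 1)"
      unfolding W by (intro sum_mono mult_mono) (auto simp: divide_le_eq totient_le)
    then show "W \<le> real n * real n" by simp
  qed
  have "real m * (real m + 1) / 2 * W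
      = (\<Sum>j = 1..n. (real n + 1 - real j) * (real m * (real m + 1) / 2 * (real (totient j) / real j)))"
    unfolding W sum_distrib_left by (intro sum.cong refl mult.left_commute)
  then have "\<bar>T - real m * (real m + 1) / 2 * W\<bar>
      = \<bar>\<Sum>j = 1..n. (real n + 1 - real j)
          * (S j - real m * (real m + 1) / 2 * (real (totient j) / real j))\<bar>"
    by (simp only: T_def right_diff_distrib sum_subtractf)
  also have "\<dots> \<le> (\<Sum>j = 1..n. real n * (real m * real (card {d. d dvd j})))"
  proof (rule order.trans[OF sum_abs], rule sum_mono)
    fix j assume j: "j \<in> {1..n}"
    show "\<bar>(real n + 1 - real j) * (S j - real m * (real m + 1) / 2 * (real (totient j) / real j))\<bar>
        \<le> real n * (real m * real (card {d. d dvd j}))"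
      unfolding abs_mult S_def using j
      by (intro mult_mono sum_coprime_weighted_approx) auto
  qed
  also have "\<dots> = real m * real n * E"
    by (simp add: E_def sum_distrib_left mult_ac)
  finally have T: "\<bar>T - real m * (real m + 1) / 2 * W\<bar> \<le> real m * real n * E" .
  define D where "D = T - real m * (real m + 1) / 2 * W"
  define Y where "Y = real m * real n ^ 2"
  \<comment> \<open>The five terms before \<open>4 * D\<close> are bounded by 2, 4, 2, 2 and 2 times
    \<open>Y\<close>, which gives the 12.\<close>
  have eq: "real (num_threshold m n) - 2 * W * real m ^ 2
      = 2 + 4 * (real m * real n) + 2 * real m + 2 * real n + 2 * (real m * W) + 4 * D"
    unfolding N D_def by (simp add: field_simps power2_eq_square)
  have "\<bar>D\<bar> \<le> real m * real n * E"
    using T by (simp only: D_def)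
  then have "- (real m * real n * E) \<le> D" "D \<le> real m * real n * E"
    by (simp_all only: abs_le_iff) linarith
  moreover have "real m * W \<le> Y" "0 \<le> real m * W"
    using W_bounds by (auto simp: Y_def power2_eq_square intro: mult_left_mono)
  moreover have "1 \<le> Y" "real m \<le> Y" "real n \<le> Y" "real m * real n \<le> Y"
  proof -
    have mn: "1 \<le> real m" "1 \<le> real n"
      using assms by simp_all
    then have n2: "real n \<le> real n ^ 2"
      by (simp add: power2_eq_square)
    then show 4: "real m * real n \<le> Y"
      unfolding Y_def by (intro mult_left_mono) auto
    have "real m * 1 \<le> real m * real n" "1 * real n \<le> real m * real n"
      using mn by (intro mult_mono; simp)+
    then show "real m \<le> Y" "real n \<le> Y" "1 \<le> Y"
      using 4 mn by linarith+
  qed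
  ultimately have "\<bar>real (num_threshold m n) - 2 * W * real m ^ 2\<bar> \<le> 12 * Y + 4 * (real m * real n * E)"
    unfolding eq using mult_nonneg_nonneg[of "real m" "real n"] by linarith
  then show ?thesis
    by (simp add: W_def E_def Y_def mult.assoc)
qed

section \<open>The four estimates with explicit constants\<close>

text \<open>Since \<open>ln n \<ge> 1 / 2\<close>, the 1 in \<open>1 + ln n\<close> is at most
  \<open>2 * ln n\<close>; at \<open>n = 1\<close> the right side would vanish.\<close>

lemma harm_le_3_ln:
  assumes "n \<ge> 2"
  shows "(harm n :: real) \<le> 3 * ln (real n)"
proof -
  have "1 / 2 \<le> ln (2 :: real)"
    using ln2_ge_two_thirds by simp
  also have "\<dots> \<le> ln (real n)"
    using assms by simp
  finally show ?thesis
    using harm_le_1_plus_ln[of n] assms by simp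
qed

(* The first error term vanishes at n = 1, where the estimate would be an exact equality
   and fails; it is therefore stated for n >= 2. *)
theorem theorem25:
  "(\<lambda>(m, n). real (num_threshold m n) - 6 / pi\<^sup>2 * real m ^ 2 * real n ^ 2)
           \<in> O[principal (wide_grids 2)](\<lambda>(m, n). real m ^ 2 * real n * ln (real n))
   \<and> (\<lambda>(m, n). real (num_threshold m n)
             - 2 * ((real n + 1) * totient_ratio_sum n - real (totient_sum n)) * real m ^ 2)
           \<in> O[principal (wide_grids 1)](\<lambda>(m, n). real m * real n ^ 3)
   \<and> (\<lambda>k. real (totient_sum k) - 3 / pi\<^sup>2 * real k ^ 2)
           \<in> O(\<lambda>k. real k * ln (real k))
   \<and> (\<lambda>k. totient_ratio_sum k - 6 / pi\<^sup>2 * real k) \<in> O(\<lambda>k. ln (real k))"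
proof (intro conjI)
  show "(\<lambda>(m, n). real (num_threshold m n) - 6 / pi\<^sup>2 * real m ^ 2 * real n ^ 2)
           \<in> O[principal (wide_grids 2)](\<lambda>(m, n). real m ^ 2 * real n * ln (real n))"
  \<comment> \<open>The constant is \<open>3 * (18 + 12 + 4)\<close>: 18 from inserting the
    approximations of Psi and Phi, 12 and 4 from \<open>num_threshold_approx\<close>, and 3 from
    \<open>harm_le_3_ln\<close>.\<close>
  proof (rule landau_o.bigI[of 102])
    show "\<forall>\<^sub>F z in principal (wide_grids 2).
        norm (case z of (m, n) \<Rightarrow> real (num_threshold m n) - 6 / pi\<^sup>2 * real m ^ 2 * real n ^ 2)
        \<le> 102 * norm (case z of (m, n) \<Rightarrow> real m ^ 2 * real n * ln (real n))"
      unfolding eventually_principal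
    proof (clarsimp simp: wide_grids_def)
      fix m n :: nat
      assume n2: "2 \<le> n" and nm: "n \<le> m"
      define \<Psi> where "\<Psi> = totient_ratio_sum n"
      define \<Phi> where "\<Phi> = real (totient_sum n)"
      define H where "H = (harm n :: real)"
      define B where "B = real m ^ 2 * (real n * H)"
      have H1: "1 \<le> H"
        using harm_mono[of 1 n, where 'a = real] n2 by (simp add: H_def harm_def)
      have pi1: "6 / pi\<^sup>2 \<le> 1"
      proof -
        have "pi\<^sup>2 \<ge> 3\<^sup>2"
          using pi_gt3 by (intro power_mono) auto
        then show ?thesis by (simp add: divide_le_eq)
      qed
      have "(real n + 1) * \<bar>\<Psi> - 6 / pi\<^sup>2 * real n\<bar> \<le> (2 * real n) * (3 * H)"
        unfolding \<Psi>_def H_def using n2 by (intro mult_mono totient_ratio_sum_approx) auto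
      then have \<Psi>: "\<bar>(real n + 1) * (\<Psi> - 6 / pi\<^sup>2 * real n)\<bar> \<le> 6 * (real n * H)"
        by (simp add: abs_mult)
      have \<Phi>: "\<bar>\<Phi> - 3 / pi\<^sup>2 * (real n)\<^sup>2\<bar> \<le> 2 * (real n * H)"
        unfolding \<Phi>_def H_def mult.assoc[symmetric, of 2] using n2 by (intro totient_sum_approx) auto
      have "6 / pi\<^sup>2 * real n \<le> 1 * real n"
        using pi1 by (intro mult_right_mono) auto
      also have "\<dots> \<le> real n * H"
        using H1 by (simp add: mult_le_cancel_left1)
      finally have small: "\<bar>6 / pi\<^sup>2 * real n\<bar> \<le> real n * H" by simp
      have combine: "\<bar>2 * x + 2 * y - 2 * z\<bar> \<le> 18 * b"
        if "\<bar>x\<bar> \<le> 6 * b" "\<bar>y\<bar> \<le> b" "\<bar>z\<bar> \<le> 2 * b" for x y z b :: real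
        using that by linarith
      \<comment> \<open>The main terms of Psi and Phi combine to \<open>6 / pi^2 * n^2\<close>, with
        a linear remainder \<open>12 / pi^2 * n\<close> that joins the error.\<close>
      have "2 * ((real n + 1) * \<Psi> - \<Phi>) - 6 / pi\<^sup>2 * real n ^ 2
          = 2 * ((real n + 1) * (\<Psi> - 6 / pi\<^sup>2 * real n)) + 2 * (6 / pi\<^sup>2 * real n)
            - 2 * (\<Phi> - 3 / pi\<^sup>2 * (real n)\<^sup>2)"
        by (simp add: algebra_simps add_divide_distrib power2_eq_square)
      then have main: "\<bar>2 * ((real n + 1) * \<Psi> - \<Phi>) - 6 / pi\<^sup>2 * real n ^ 2\<bar> \<le> 18 * (real n * H)"
        using combine[OF \<Psi> small \<Phi>] by (simp only:)
      have "2 * ((real n + 1) * \<Psi> - \<Phi>) * real m ^ 2 - 6 / pi\<^sup>2 * real m ^ 2 * real n ^ 2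
          = real m ^ 2 * (2 * ((real n + 1) * \<Psi> - \<Phi>) - 6 / pi\<^sup>2 * real n ^ 2)"
        by (simp add: algebra_simps)
      then have "\<bar>2 * ((real n + 1) * \<Psi> - \<Phi>) * real m ^ 2 - 6 / pi\<^sup>2 * real m ^ 2 * real n ^ 2\<bar>
          = real m ^ 2 * \<bar>2 * ((real n + 1) * \<Psi> - \<Phi>) - 6 / pi\<^sup>2 * real n ^ 2\<bar>"
        by (simp only: abs_mult abs_power2)
      also have "\<dots> \<le> real m ^ 2 * (18 * (real n * H))"
        using main by (intro mult_left_mono) auto
      finally have 1: "\<bar>2 * ((real n + 1) * \<Psi> - \<Phi>) * real m ^ 2
          - 6 / pi\<^sup>2 * real m ^ 2 * real n ^ 2\<bar> \<le> 18 * B"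
        by (simp only: B_def mult.left_commute[of "real m ^ 2" 18])
      \<comment> \<open>Here \<open>n \<le> m\<close> trades one factor \<open>n\<close> for
        \<open>m\<close>.\<close>
      have "real m * real n ^ 2 \<le> real m * (real n * real m)"
        unfolding power2_eq_square using nm by (intro mult_left_mono) simp_all
      also have "\<dots> = real m ^ 2 * real n * 1"
        by (simp add: power2_eq_square)
      also have "\<dots> \<le> real m ^ 2 * real n * H"
        using H1 by (intro mult_left_mono) auto
      also have "\<dots> = B"
        by (simp only: B_def mult.assoc)
      finally have 2: "12 * real m * real n ^ 2 \<le> 12 * B"
        by (simp only: mult.assoc mult_le_cancel_left_pos zero_less_numeral)
      have "real m * real n * (\<Sum>j = 1..n. real (card {d. d dvd j})) \<le> real m * real m * (real n * H)"
        unfolding H_def using nm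
        by (intro mult_mono[OF _ sum_card_divisors_le] mult_left_mono sum_nonneg) simp_all
      also have "\<dots> = B"
        by (simp only: B_def power2_eq_square)
      finally have 3: "4 * real m * real n * (\<Sum>j = 1..n. real (card {d. d dvd j})) \<le> 4 * B"
        by (simp only: mult.assoc mult_le_cancel_left_pos zero_less_numeral)
      have "\<bar>x - z\<bar> \<le> 34 * B" if "\<bar>x - y\<bar> \<le> u + v" "\<bar>y - z\<bar> \<le> 18 * B" "u \<le> 12 * B" "v \<le> 4 * B"
        for x y z u v :: real
        using that by linarith
      moreover have "m > 0" "n > 0"
        using n2 nm by auto
      ultimately have "\<bar>real (num_threshold m n) - 6 / pi\<^sup>2 * real m ^ 2 * real n ^ 2\<bar> \<le> 34 * B"
        using num_threshold_approx 1[unfolded \<Psi>_def \<Phi>_def] 2 3 by blast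
      also have "\<dots> \<le> 34 * (real m ^ 2 * (real n * (3 * ln (real n))))"
        unfolding B_def H_def using harm_le_3_ln[OF n2] by (intro mult_left_mono) auto
      also have "\<dots> = 102 * ((real m)\<^sup>2 * real n * ln (real n))"
        by (simp only: mult.left_commute[of _ 3] mult.assoc)
      finally show "\<bar>real (num_threshold m n) - 6 * (real m)\<^sup>2 * (real n)\<^sup>2 / pi\<^sup>2\<bar>
          \<le> 102 * ((real m)\<^sup>2 * real n * ln (real n))"
        by (simp only: times_divide_eq_left)
    qed
  qed simp
next
  show "(\<lambda>(m, n). real (num_threshold m n)
             - 2 * ((real n + 1) * totient_ratio_sum n - real (totient_sum n)) * real m ^ 2)
           \<in> O[principal (wide_grids 1)](\<lambda>(m, n). real m * real n ^ 3)"
  proof (rule landau_o.bigI[of 16])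
    show "\<forall>\<^sub>F z in principal (wide_grids 1).
        norm (case z of (m, n) \<Rightarrow> real (num_threshold m n)
             - 2 * ((real n + 1) * totient_ratio_sum n - real (totient_sum n)) * real m ^ 2)
        \<le> 16 * norm (case z of (m, n) \<Rightarrow> real m * real n ^ 3)"
      unfolding eventually_principal
    proof (intro ballI, unfold split_paired_all case_prod_conv)
      fix m n :: nat
      assume "(m, n) \<in> wide_grids 1"
      then have n1: "1 \<le> n" and nm: "n \<le> m"
        by (auto simp: wide_grids_def)
      \<comment> \<open>The trivial bound suffices: all divisors of \<open>j\<close> lie in
        \<open>{1..n}\<close>.\<close>
      have "(\<Sum>j = 1..n. real (card {d. d dvd j})) \<le> (\<Sum>j = 1..n. real n)"
      proof (rule sum_mono)
        fix j assume j: "j \<in> {1..n}"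
        have "d \<in> {1..n}" if "d dvd j" for d
          using j that dvd_imp_le[OF that] dvd_pos_nat[OF _ that] by simp
        then have "card {d. d dvd j} \<le> card {1..n}"
          by (intro card_mono) auto
        then show "real (card {d. d dvd j}) \<le> real n"
          by simp
      qed
      then have "4 * real m * real n * (\<Sum>j = 1..n. real (card {d. d dvd j}))
          \<le> 4 * real m * real n * (real n * real n)"
        by (intro mult_left_mono) auto
      also have "\<dots> = 4 * (real m * real n ^ 3)"
        by (simp only: power3_eq_cube mult.assoc)
      finally have 1: "4 * real m * real n * (\<Sum>j = 1..n. real (card {d. d dvd j})) \<le> 4 * (real m * real n ^ 3)" .
      have "12 * real m * real n ^ 2 * 1 \<le> 12 * real m * real n ^ 2 * real n"
        using n1 by (intro mult_left_mono) auto
      also have "\<dots> = 12 * (real m * real n ^ 3)"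
        by (simp only: power3_eq_cube power2_eq_square mult.assoc)
      finally have 2: "12 * real m * real n ^ 2 \<le> 12 * (real m * real n ^ 3)"
        by simp
      have "\<bar>x\<bar> \<le> 16 * z" if "\<bar>x\<bar> \<le> u + v" "u \<le> 12 * z" "v \<le> 4 * z" for x z u v :: real
        using that by linarith
      moreover have "m > 0" "n > 0"
        using n1 nm by auto
      ultimately have "\<bar>real (num_threshold m n)
             - 2 * ((real n + 1) * totient_ratio_sum n - real (totient_sum n)) * real m ^ 2\<bar>
          \<le> 16 * (real m * real n ^ 3)"
        using num_threshold_approx 1 2 by blast
      also have "real m * real n ^ 3 = norm (real m * real n ^ 3)"
        by simp
      finally show "norm (real (num_threshold m n)
             - 2 * ((real n + 1) * totient_ratio_sum n - real (totient_sum n)) * real m ^ 2)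
          \<le> 16 * norm (real m * real n ^ 3)"
        unfolding real_norm_def .
    qed
  qed simp
next
  show "(\<lambda>k. real (totient_sum k) - 3 / pi\<^sup>2 * real k ^ 2) \<in> O(\<lambda>k. real k * ln (real k))"
  proof (rule landau_o.bigI[of 6])
    show "\<forall>\<^sub>F k in at_top. norm (real (totient_sum k) - 3 / pi\<^sup>2 * real k ^ 2)
        \<le> 6 * norm (real k * ln (real k))"
      using eventually_ge_at_top[of 2]
    proof eventually_elim
      case (elim k)
      have "\<bar>real (totient_sum k) - 3 / pi\<^sup>2 * real k ^ 2\<bar> \<le> 2 * real k * harm k"
        using elim by (intro totient_sum_approx) simp
      also have "\<dots> \<le> 2 * real k * (3 * ln (real k))"
        using harm_le_3_ln[OF elim] by (intro mult_left_mono) auto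
      also have "\<dots> = 6 * norm (real k * ln (real k))"
        using elim by (simp add: abs_mult)
      finally show ?case
        by (simp only: real_norm_def)
    qed
  qed simp
next
  show "(\<lambda>k. totient_ratio_sum k - 6 / pi\<^sup>2 * real k) \<in> O(\<lambda>k. ln (real k))"
  proof (rule landau_o.bigI[of 9])
    show "\<forall>\<^sub>F k in at_top. norm (totient_ratio_sum k - 6 / pi\<^sup>2 * real k) \<le> 9 * norm (ln (real k))"
      using eventually_ge_at_top[of 2]
    proof eventually_elim
      case (elim k)
      then show ?case
        using totient_ratio_sum_approx[of k] harm_le_3_ln[OF elim] by simp
    qed
  qed simp
qed

end
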